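(* Let $\Sigma$ be a finite non-empty alphabet. (1) Let $u,w\in\Sigma^*$, let $\ell\in[|u|-1]_0$ and let $v\in\mathrm{CSF}(u,w)$. If $\ell+|v|=|u|$ and $p(u)\le p(w)$, then $u\in\mathrm{JScatFact}(w,\ell)$. (2) For every $w\in\Sigma^*$, every $\ell\in\mathbb N_0$ and every $u\in\mathrm{JScatFact}(w,\ell)$ there exists $v\in\mathrm{CSF}(u,w)$ such that $\ell+|v|=|u|$. (3) For every $w\in\Sigma^*$, every $u\in\mathrm{JScatFact}(w)$ and every $\ell\in\mathbb N$, we have $u\in\overline{\mathrm{JScatFact}}(w,\ell)$ if and only if $\ell=|u|-\mathrm{lcsf}(u,w)$. Thus $\delta_w(u)=|u|-\mathrm{lcsf}(u,w)$.
   Context: $\mathbb N=\{1,2,\dots\}$, $\mathbb N_0=\mathbb N\cup\{0\}$; $[n]=\{1,\dots,n\}$ (empty for $n\le 0$) and $[n]_0=[n]\cup\{0\}$. For a word $w\in\Sigma^*$, $|w|$ is its length and $|w|_a$ the number of occurrences of the letter $a$ in $w$. The Parikh vector of $w$ is $p(w)=(|w|_a)_{a\in\Sigma}$, and $p(u)\le p(w)$ means $|u|_a\le|w|_a$ for all $a\in\Sigma$. A scattered factor of $w$ is a (not necessarily contiguous) subsequence of $w$; $\mathrm{ScatFact}(w)$ is the set of all of them. For $S\subseteq\Sigma^*$, $S_k=S\cap\Sigma^k$. $\mathrm{CSF}(u,w)=\mathrm{ScatFact}(u)\cap\mathrm{ScatFact}(w)$, and $\mathrm{lcsf}(u,w)$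 is the maximal length of an element of $\mathrm{CSF}(u,w)$. $\mathrm{JScatFact}(w)$ is the set of words $u$ for which there is $v\in\mathrm{ScatFact}(w)$ with $p(u)=p(v)$. For $\ell\in\mathbb N_0$, $\mathrm{JScatFact}(w,\ell)$ is the set of words $u$ such that $\ell\in[|u|-1]_0$, $p(u)\le p(w)$, and there exists $v\in\mathrm{ScatFact}_{|u|-\ell}(u)$ with $v\in\mathrm{ScatFact}(w)$. For $u\in\mathrm{JScatFact}(w)$, the jumble index is $\delta_w(u)=\min\{\ell\in\mathbb N_0: u\in\mathrm{JScatFact}(w,\ell)\}$, and $\overline{\mathrm{JScatFact}}(w,\ell)=\{u\in\mathrm{JScatFact}(w,\ell):\delta_w(u)=\ell\}$. *)

theory Defs
  imports Main "HOL-Library.Sublist"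
begin

(* Words over an alphabet \<Sigma> are the elements of lists \<Sigma>.  The notions below need no
   alphabet argument: a word over \<Sigma> has no occurrences of letters outside \<Sigma>, and every
   word in jscat_fact w, jscat_fact_dist w l or scat_fact w uses only letters of w. *)

definition parikh :: "'a list \<Rightarrow> 'a \<Rightarrow> nat" where
  "parikh w = (\<lambda>a. count_list w a)"

definition scat_fact :: "'a list \<Rightarrow> 'a list set" where
  "scat_fact w = {v. subseq v w}"

definition of_length :: "'a list set \<Rightarrow> nat \<Rightarrow> 'a list set" where
  "of_length S k = {v \<in> S. length v = k}"

definition csf :: "'a list \<Rightarrow> 'a list \<Rightarrow> 'a list set" where
  "csf u w = scat_fact u \<inter> scat_fact w"

definition lcsf :: "'a list \<Rightarrow> 'a list \<Rightarrow> nat" where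
  "lcsf u w = Max (length ` csf u w)"

definition jscat_fact :: "'a list \<Rightarrow> 'a list set" where
  "jscat_fact w = {u. \<exists>v \<in> scat_fact w. parikh u = parikh v}"

(* Truncated subtraction gives {0..length u - 1} = {0} for the empty word u, in agreement
   with the convention that the set {1,...,n} is empty for n \<le> 0 and 0 is then adjoined. *)
definition jscat_fact_dist :: "'a list \<Rightarrow> nat \<Rightarrow> 'a list set" where
  "jscat_fact_dist w l = {u. l \<in> {0..length u - 1} \<and> parikh u \<le> parikh w \<and>
     (\<exists>v \<in> of_length (scat_fact u) (length u - l). v \<in> scat_fact w)}"

(* Meaningful for u in jscat_fact w, where the minimum is over a nonempty set. *)
definition jumble_index :: "'a list \<Rightarrow> 'a list \<Rightarrow> nat" where
  "jumble_index w u = (LEAST l. u \<in> jscat_fact_dist w l)"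

definition jscat_fact_exact :: "'a list \<Rightarrow> nat \<Rightarrow> 'a list set" where
  "jscat_fact_exact w l = {u \<in> jscat_fact_dist w l. jumble_index w u = l}"

end

theory Submission
  imports Defs
begin

text \<open>Deleting letters from \<open>u\<close> to reach a scattered factor of \<open>w\<close> is the same as choosing a
  common scattered factor, so the fewest deletions are achieved by a longest one. The side condition
  \<open>\<ell> < |u|\<close> is harmless for this choice: if \<open>u\<close> is nonempty and \<open>p(u) \<le> p(w)\<close>, then the first
  letter of \<open>u\<close> is a common scattered factor, so a longest one is nonempty.\<close>

lemma parikh_subseq_mono: "subseq v w \<Longrightarrow> parikh v \<le> parikh w"
  by (auto simp: parikh_def le_fun_def count_list_eq_length_filter intro!: list_emb_length subseq_filter)

text \<open>Supplies the Parikh bound that the later lemmas assume: \<open>u\<close> has the Parikh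
  vector of some subsequence of \<open>w\<close>.\<close>

lemma jscat_fact_parikh_le: "u \<in> jscat_fact w \<Longrightarrow> parikh u \<le> parikh w"
  by (auto simp: jscat_fact_def scat_fact_def parikh_subseq_mono)

lemma jscat_fact_dist_iff:
  "u \<in> jscat_fact_dist w l \<longleftrightarrow>
    l \<le> length u - 1 \<and> parikh u \<le> parikh w \<and> (\<exists>v \<in> csf u w. l + length v = length u)"
proof -
  \<comment> \<open>The bound gives \<open>l \<le> length u\<close>, so the subtraction is not
    truncated; for larger \<open>l\<close> the empty word would satisfy only the left side.\<close>
  have "length v = length u - l \<longleftrightarrow> l + length v = length u" if "l \<le> length u - 1" for v
    using that by linarith
  then show ?thesis
    by (auto simp: jscat_fact_dist_def of_length_def csf_def)
qed

text \<open>Makes the \<open>Max\<close> in \<open>lcsf\<close> meaningful, together with the empty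
  word as a member of \<open>csf u w\<close>.\<close>

lemma finite_csf: "finite (csf u w)"
proof -
  have "csf u w \<subseteq> set (subseqs u)"
    by (auto simp: csf_def scat_fact_def)
  then show ?thesis
    by (rule finite_subset) simp
qed

lemma Nil_in_csf: "[] \<in> csf u w"
  by (simp add: csf_def scat_fact_def)

lemma lcsf_ge: "v \<in> csf u w \<Longrightarrow> length v \<le> lcsf u w"
  by (simp add: lcsf_def finite_csf)

lemma lcsf_attained: obtains v where "v \<in> csf u w" "length v = lcsf u w"
proof -
  have "lcsf u w \<in> length ` csf u w"
    unfolding lcsf_def using finite_csf Nil_in_csf[of u w] by (intro Max_in) auto
  then show ?thesis
    using that by auto
qed

lemma lcsf_le_length: "lcsf u w \<le> length u"
  by (rule lcsf_attained[of u w]) (auto simp: csf_def scat_fact_def dest: list_emb_length)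

lemma lcsf_pos:
  assumes "u \<noteq> []" "parikh u \<le> parikh w"
  shows "0 < lcsf u w"
proof -
  from assms(1) obtain a u' where u: "u = a # u'"
    by (cases u) auto
  have "count_list u a \<le> count_list w a"
    using assms(2) by (simp add: parikh_def le_fun_def)
  then have "a \<in> set w"
    using u count_list_0_iff[of w a] by auto
  then have "[a] \<in> csf u w"
    by (simp add: u csf_def scat_fact_def subseq_singleton_left)
  from lcsf_ge[OF this] show ?thesis
    by simp
qed

lemma in_jscat_fact_dist_lcsf:
  assumes "parikh u \<le> parikh w"
  shows "u \<in> jscat_fact_dist w (length u - lcsf u w)"
proof -
  obtain v where "v \<in> csf u w" "length v = lcsf u w"
    by (rule lcsf_attained)
  moreover have "length u - lcsf u w \<le> length u - 1"
    \<comment> \<open>For \<open>u = []\<close> both differences are 0; otherwise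
      \<open>lcsf u w \<ge> 1\<close>.\<close>
    using lcsf_pos[OF _ assms] by (cases "u = []") (auto simp: Suc_le_eq intro: diff_le_mono2)
  ultimately show ?thesis
    using assms lcsf_le_length[of u w] by (auto simp: jscat_fact_dist_iff intro!: bexI[of _ v])
qed

lemma jumble_index_eq:
  assumes "parikh u \<le> parikh w"
  shows "jumble_index w u = length u - lcsf u w"
  unfolding jumble_index_def
proof (rule Least_equality)
  show "u \<in> jscat_fact_dist w (length u - lcsf u w)"
    by (rule in_jscat_fact_dist_lcsf[OF assms])
next
  fix l assume "u \<in> jscat_fact_dist w l"
  then obtain v where "v \<in> csf u w" "l + length v = length u"
    by (auto simp: jscat_fact_dist_iff)
  \<comment> \<open>Minimality: the word left after \<open>l\<close> deletions is no longer than
    \<open>lcsf u w\<close>.\<close>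
  then show "length u - lcsf u w \<le> l"
    using lcsf_ge[of v u w] by simp
qed

lemma jscat_fact_exact_iff:
  assumes "parikh u \<le> parikh w"
  shows "u \<in> jscat_fact_exact w l \<longleftrightarrow> l = length u - lcsf u w"
  using in_jscat_fact_dist_lcsf[OF assms] jumble_index_eq[OF assms]
  by (auto simp: jscat_fact_exact_def)

theorem lemma9:
  fixes \<Sigma> :: "'a set"
  assumes "finite \<Sigma>" and "\<Sigma> \<noteq> {}"
  shows
    "(\<forall>u \<in> lists \<Sigma>. \<forall>w \<in> lists \<Sigma>. \<forall>l \<in> {0..length u - 1}. \<forall>v \<in> csf u w.
        l + length v = length u \<and> parikh u \<le> parikh w \<longrightarrow> u \<in> jscat_fact_dist w l) \<and>
     (\<forall>w \<in> lists \<Sigma>. \<forall>l. \<forall>u \<in> jscat_fact_dist w l.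
        \<exists>v \<in> csf u w. l + length v = length u) \<and>
     (\<forall>w \<in> lists \<Sigma>. \<forall>u \<in> jscat_fact w.
        (\<forall>l \<ge> 1. u \<in> jscat_fact_exact w l \<longleftrightarrow> l = length u - lcsf u w) \<and>
        jumble_index w u = length u - lcsf u w)"
  \<comment> \<open>The first two claims are the two directions of
    \<open>jscat_fact_dist_iff\<close>; the third follows from the value of the jumble
    index.\<close>
  by (auto simp: jscat_fact_dist_iff jscat_fact_exact_iff jumble_index_eq jscat_fact_parikh_le)

end
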